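(* Let $f(\mathbf{x}):=e^{\mathbf{1}^\top\mathbf{x}}-1$ on $\mathbb{R}^d$. (a) Let $k>0$ be fixed, and for $u>0$ let $\mathbf{v}_0:=ku\mathbf{1}\in\mathbb{R}^d_{>0}$ and $J:=\operatorname{conv}\{\mathbf{v}_0,\mathbf{v}_0-u\mathbf{e}_1,\dots,\mathbf{v}_0-u\mathbf{e}_d\}$. Then $$\lim_{u\to\infty}u^d\cdot\frac{\operatorname{vol}(P^0(f,J))-\operatorname{vol}(P(f,J))}{\operatorname{vol}(P^0(f,J))}=(d+1)!.$$ (b) Let $\mathbf{v}_0\in\mathbb{R}^d_{\ge0}\setminus\{\mathbf{0}\}$ be fixed and for $u>0$ let $J:=\operatorname{conv}\{\mathbf{v}_0,\mathbf{v}_0+u\mathbf{e}_1,\dots,\mathbf{v}_0+u\mathbf{e}_d\}$. Then $$\lim_{u\to\infty}u\cdot\frac{\operatorname{vol}(P^0(f,J))-\operatorname{vol}(P(f,J))}{\operatorname{vol}(P^0(f,J))}=d+1.$$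
   Context: $\mathbf{e}_j$ is the $j$-th unit vector and $\mathbf{1}$ the all-ones vector in $\mathbb{R}^d$. Let $\mu$ be the unique affine function agreeing with $f$ at the vertices of $J$ and $\mu(\mathbf{x},z):=z\mu(\mathbf{x}/z)$ (extended linearly in $(\mathbf{x},z)$). For $z\ge0$, $z\cdot J:=\{z\mathbf{x}:\mathbf{x}\in J\}$. Perspective relaxation: $P(f,J):=\operatorname{cl}\{(\mathbf{x},y,z)\in\mathbb{R}^d\times\mathbb{R}\times\mathbb{R}:\mu(\mathbf{x},z)\ge y\ge zf(\mathbf{x}/z),\ \mathbf{x}\in z\cdot J,\ 1\ge z>0\}$. Naive relaxation: $P^0(f,J):=\{(\mathbf{x},y,z)\in\mathbb{R}^d\times\mathbb{R}\times\mathbb{R}:\mu(\mathbf{x},z)\ge y\ge f(\mathbf{x}),\ \mathbf{x}\in z\cdot J,\ 1\ge z\ge0\}$. $\operatorname{vol}$ is $(d+2)$-dimensional Lebesgue measure. *)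

theory Defs
  imports "HOL-Analysis.Analysis"
begin

definition expf :: "real^'n \<Rightarrow> real" where
  "expf x = exp (\<Sum>i\<in>UNIV. x $ i) - 1"

definition affine_interp :: "(real^'n \<Rightarrow> real) \<Rightarrow> (real^'n) set \<Rightarrow> (real^'n \<Rightarrow> real)" where
  "affine_interp f V = (THE g. (\<exists>a b. g = (\<lambda>x. a \<bullet> x + b)) \<and> (\<forall>v\<in>V. g v = f v))"

text \<open>Homogenization mu(x,z) = z mu(x/z), extended linearly in (x,z):
  for affine g(x) = a.x + b this is a.x + b z.\<close>
definition persp_mu :: "(real^'n \<Rightarrow> real) \<Rightarrow> (real^'n) set \<Rightarrow> real^'n \<Rightarrow> real \<Rightarrow> real" where
  "persp_mu f V x z =
     affine_interp f V x - affine_interp f V 0 + z * affine_interp f V 0"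

definition persp_relax :: "(real^'n \<Rightarrow> real) \<Rightarrow> (real^'n) set \<Rightarrow> ((real^'n) \<times> real \<times> real) set" where
  "persp_relax f V = closure {(x, y, z). persp_mu f V x z \<ge> y \<and> y \<ge> z * f ((1 / z) *\<^sub>R x)
      \<and> x \<in> (\<lambda>w. z *\<^sub>R w) ` (convex hull V) \<and> z \<le> 1 \<and> 0 < z}"

definition naive_relax :: "(real^'n \<Rightarrow> real) \<Rightarrow> (real^'n) set \<Rightarrow> ((real^'n) \<times> real \<times> real) set" where
  "naive_relax f V = {(x, y, z). persp_mu f V x z \<ge> y \<and> y \<ge> f x
      \<and> x \<in> (\<lambda>w. z *\<^sub>R w) ` (convex hull V) \<and> z \<le> 1 \<and> 0 \<le> z}"

definition rel_gap :: "(real^'n \<Rightarrow> real) \<Rightarrow> (real^'n) set \<Rightarrow> real" where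
  "rel_gap f V = (measure lborel (naive_relax f V) - measure lborel (persp_relax f V))
                 / measure lborel (naive_relax f V)"

end

theory Submission
  imports Defs "HOL-Probability.Distribution_Functions" "HOL-Real_Asymp.Real_Asymp"
begin

text \<open>
  Both families of simplices have the form \<open>J = v + c \<Delta>\<close>, where \<open>\<Delta>\<close> is the standard simplex and
  \<open>c = -u\<close> in (a), \<open>c = u\<close> in (b). Put \<open>s = 1\<^sup>Tv\<close>, let \<open>d = m + 1\<close> be the dimension, and let
  \<open>f(x) = \<phi>(1\<^sup>Tx)\<close> with \<open>\<phi>\<close> convex and \<open>\<phi>(0) = 0\<close>. In the coordinates \<open>x = z (v + c t)\<close> all functions
  bounding \<open>y\<close> depend on \<open>t\<close> only through \<open>r = 1\<^sup>Tt\<close>, whose distribution on \<open>\<Delta>\<close> has density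
  \<open>r\<^sup>m / m!\<close> on \<open>[0, 1]\<close>. With \<open>R(s, c) = \<integral>\<^sub>0\<^sup>1 \<phi>(s + cr) r\<^sup>m / m! dr\<close>, \<open>K = \<integral>\<^sub>0\<^sup>1 z\<^sup>d R(zs, zc) dz\<close> and
  \<open>C = (\<phi>(s) + d \<phi>(s + c)) / (d + 1)!\<close> the relative gap is therefore \<open>(R - (d + 2) K) / (C - (d + 2) K)\<close>.

  For \<open>\<phi>(a) = e\<^sup>a - 1\<close> this simplifies to \<open>(F(c) + \<epsilon>) / ((1 + d e\<^sup>c) / (d + 1)! + \<epsilon>)\<close>, where
  \<open>F(c) = \<integral>\<^sub>0\<^sup>1 e\<^bsup>cr\<^esup> r\<^sup>m / m! dr\<close> and \<open>\<epsilon> = e\<^bsup>-s\<^esup> (1 / (d + 1)! - (d + 2) N)\<close> with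
  \<open>N = \<integral>\<^sub>0\<^sup>1 z\<^sup>d e\<^bsup>zs\<^esup> F(zc) dz\<close>. In (a), \<open>u\<^sup>d F(-u) \<longlongrightarrow> 1\<close> and \<open>u\<^sup>d N \<le> e\<^sup>s / s\<close>; in (b),
  \<open>u e\<^bsup>-u\<^esup> F(u) \<longlongrightarrow> 1 / m!\<close> and \<open>u N \<le> e\<^bsup>s+u\<^esup> / u\<close>. So \<open>\<epsilon>\<close> is negligible in both cases.
\<close>

subsection \<open>Integration over the standard simplex\<close>

definition divided_power :: "nat \<Rightarrow> real \<Rightarrow> real" where
  "divided_power m r = r ^ m / fact m"

lemma divided_power_nonneg: "0 \<le> r \<Longrightarrow> 0 \<le> divided_power m r"
  by (simp add: divided_power_def)

lemma continuous_on_divided_power [continuous_intros]: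
  "continuous_on A f \<Longrightarrow> continuous_on A (\<lambda>x. divided_power m (f x))"
  unfolding divided_power_def by (intro continuous_intros) auto

lemma borel_measurable_divided_power [measurable]: "divided_power m \<in> borel_measurable borel"
  by (intro borel_measurable_continuous_onI continuous_intros)

lemma has_real_derivative_divided_power:
  "(divided_power (Suc m) has_real_derivative divided_power m x) (at x within A)"
proof -
  have "((\<lambda>x::real. x ^ Suc m / fact (Suc m)) has_real_derivative
      real (Suc m) * x ^ m / (real (Suc m) * fact m)) (at x within A)"
    by (auto intro!: derivative_eq_intros simp del: power_Suc)
  then show ?thesis
    unfolding divided_power_def by (subst (asm) mult_divide_mult_cancel_left) auto
qed

lemma nn_integral_divided_power:
  "(\<integral>\<^sup>+r\<in>{0..s}. ennreal (divided_power m r) \<partial>lborel) = ennreal (divided_power (Suc m) (max 0 s))"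
proof (cases "0 \<le> s")
  case True
  have "(\<integral>\<^sup>+r\<in>{0..s}. ennreal (divided_power m r) \<partial>lborel)
      = ennreal (divided_power (Suc m) s - divided_power (Suc m) 0)"
    by (rule nn_integral_FTC_Icc)
      (use True in \<open>auto intro: has_real_derivative_divided_power divided_power_nonneg\<close>)
  with True show ?thesis by (simp add: divided_power_def)
qed (simp add: divided_power_def)

definition coord_simplex :: "real \<Rightarrow> 'a::euclidean_space set" where
  "coord_simplex s = {t. (\<forall>b\<in>Basis. 0 \<le> t \<bullet> b) \<and> One \<bullet> t \<le> s}"

lemma One_inner: "One \<bullet> x = (\<Sum>b\<in>Basis. x \<bullet> b)"
  by (simp only: inner_sum_left inner_commute[of x])

lemma convex_hull_0_Basis: "convex hull (insert 0 Basis) = coord_simplex 1"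
  by (simp add: std_simplex coord_simplex_def One_inner)

lemma closed_coord_simplex: "closed (coord_simplex s :: 'a::euclidean_space set)"
proof -
  have "coord_simplex s = (\<Inter>b\<in>Basis. {t :: 'a. 0 \<le> t \<bullet> b}) \<inter> {t. One \<bullet> t \<le> s}"
    by (auto simp: coord_simplex_def)
  then show ?thesis
    by (auto intro!: closed_Int closed_INT closed_Collect_le continuous_intros)
qed

lemma coord_simplex_in_borel [measurable]: "coord_simplex s \<in> sets borel"
  by (intro borel_closed closed_coord_simplex)

lemma emeasure_coord_simplex:
  "emeasure lborel (coord_simplex s :: 'a::euclidean_space set) = ennreal (divided_power DIM('a) (max 0 s))"
proof (cases "0 \<le> s")
  case True
  have "emeasure lborel (coord_simplex s :: 'a set) =
          emeasure (distr (Pi\<^sub>M Basis (\<lambda>b. lborel)) borel (\<lambda>f. \<Sum>b\<in>Basis. f b *\<^sub>R b))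
            (coord_simplex s :: 'a set)"
    by (subst lborel_eq) simp
  also have "\<dots> = emeasure (Pi\<^sub>M (Basis :: 'a set) (\<lambda>b. lborel))
      ({y. (\<forall>i\<in>Basis. 0 \<le> y i) \<and> sum y Basis \<le> s} \<inter> space (Pi\<^sub>M Basis (\<lambda>b. lborel)))"
    by (subst emeasure_distr)
      (auto simp: coord_simplex_def One_inner intro!: arg_cong2[where f=emeasure])
  also have "\<dots> = ennreal (divided_power DIM('a) (max 0 s))"
    using True by (subst emeasure_std_simplex_aux) (auto simp: divided_power_def)
  finally show ?thesis .
next
  case False
  have "0 \<le> One \<bullet> t" if "\<forall>b\<in>Basis. 0 \<le> t \<bullet> b" for t :: 'a
    using that by (simp add: One_inner sum_nonneg)
  with False have "coord_simplex s = ({} :: 'a set)"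
    by (force simp: coord_simplex_def)
  with False show ?thesis by (simp add: divided_power_def)
qed

lemma distr_coord_sum_simplex:
  "distr (density lborel (indicator (coord_simplex 1 :: 'a::euclidean_space set))) borel ((\<bullet>) One)
     = density lborel (\<lambda>r. ennreal (divided_power (DIM('a) - 1) r) * indicator {0..1} r)"
    (is "?M = ?N")
proof (rule cdf_unique')
  let ?D = "coord_simplex 1 :: 'a set"
  have emeasure_M: "emeasure ?M {..x} = ennreal (divided_power DIM('a) (max 0 (min 1 x)))" for x
  proof -
    have [measurable]: "(\<bullet>) (One :: 'a) -` {..x} \<in> sets borel"
      using measurable_sets[of "(\<bullet>) (One :: 'a)" borel borel "{..x}"] by simp
    have "emeasure ?M {..x} = (\<integral>\<^sup>+t. indicator ?D t * indicator ((\<bullet>) One -` {..x}) t \<partial>lborel)"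
      by (simp add: emeasure_distr emeasure_density)
    also have "\<dots> = (\<integral>\<^sup>+t. indicator (coord_simplex (min 1 x) :: 'a set) t \<partial>lborel)"
      by (intro nn_integral_cong) (auto simp: coord_simplex_def split: split_indicator)
    also have "\<dots> = ennreal (divided_power DIM('a) (max 0 (min 1 x)))"
      by (simp add: emeasure_coord_simplex)
    finally show ?thesis .
  qed
  have emeasure_N: "emeasure ?N {..x} = ennreal (divided_power DIM('a) (max 0 (min 1 x)))" for x
  proof -
    have "emeasure ?N {..x} = (\<integral>\<^sup>+r\<in>{0..min 1 x}. ennreal (divided_power (DIM('a) - 1) r) \<partial>lborel)"
      by (subst emeasure_density) (auto intro!: nn_integral_cong split: split_indicator)
    then show ?thesis by (simp add: nn_integral_divided_power)
  qed
  show "cdf ?M = cdf ?N"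
    unfolding cdf_def measure_def emeasure_M emeasure_N ..
  have "emeasure ?M (space ?M) = ennreal (divided_power DIM('a) 1)"
    using emeasure_coord_simplex[of 1, where 'a='a] by (simp add: emeasure_distr emeasure_density)
  then show "finite_borel_measure ?M"
    by (intro finite_borel_measure.intro finite_measureI finite_borel_measure_axioms.intro) auto
  have "emeasure ?N (space ?N) = ennreal (divided_power DIM('a) 1)"
    using nn_integral_divided_power[of "DIM('a) - 1" 1] by (simp add: emeasure_density)
  then show "finite_borel_measure ?N"
    by (intro finite_borel_measure.intro finite_measureI finite_borel_measure_axioms.intro) auto
qed

lemma nn_integral_coord_simplex:
  fixes g :: "real \<Rightarrow> ennreal"
  assumes [measurable]: "g \<in> borel_measurable borel"
  shows "(\<integral>\<^sup>+t\<in>coord_simplex 1. g (One \<bullet> (t::'a::euclidean_space)) \<partial>lborel)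
       = (\<integral>\<^sup>+r\<in>{0..1}. g r * ennreal (divided_power (DIM('a) - 1) r) \<partial>lborel)"
proof -
  have "(\<integral>\<^sup>+t\<in>coord_simplex 1. g (One \<bullet> (t::'a)) \<partial>lborel)
      = (\<integral>\<^sup>+r. g r \<partial>distr (density lborel (indicator (coord_simplex 1 :: 'a set))) borel ((\<bullet>) One))"
    by (simp add: nn_integral_distr nn_integral_density mult.commute)
  then show ?thesis
    unfolding distr_coord_sum_simplex by (simp add: nn_integral_density mult_ac)
qed

lemma nn_integral_lborel_affine:
  fixes f :: "'a::euclidean_space \<Rightarrow> ennreal"
  assumes [measurable]: "f \<in> borel_measurable borel" and "a \<noteq> 0"
  shows "(\<integral>\<^sup>+x. f x \<partial>lborel) = ennreal (\<bar>a\<bar> ^ DIM('a)) * (\<integral>\<^sup>+t. f (b + a *\<^sub>R t) \<partial>lborel)"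
  by (subst lborel_affine[OF \<open>a \<noteq> 0\<close>, of b])
    (simp add: nn_integral_density nn_integral_distr nn_integral_cmult)

definition corner_vertices :: "'a::euclidean_space \<Rightarrow> real \<Rightarrow> 'a set" where
  "corner_vertices v c = insert v ((\<lambda>b. v + c *\<^sub>R b) ` Basis)"

lemma convex_hull_corner_vertices:
  "convex hull (corner_vertices v c) = (\<lambda>t. v + c *\<^sub>R t) ` coord_simplex 1"
proof -
  have "corner_vertices v c = (\<lambda>t. v + c *\<^sub>R t) ` insert 0 Basis"
    by (simp add: corner_vertices_def)
  then show ?thesis
    by (simp only: convex_hull_affinity convex_hull_0_Basis)
qed

lemma finite_corner_vertices: "finite (corner_vertices v c)"
  by (simp add: corner_vertices_def)

lemma corner_vertices_nonempty: "corner_vertices v c \<noteq> {}"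
  by (simp add: corner_vertices_def)

lemma finite_imp_closed_convex_hull:
  fixes S :: "'a::euclidean_space set"
  shows "finite S \<Longrightarrow> closed (convex hull S)"
  by (intro compact_imp_closed finite_imp_compact_convex_hull)

lemma nn_integral_corner:
  fixes v :: "'a::euclidean_space" and g :: "real \<Rightarrow> ennreal"
  assumes [measurable]: "g \<in> borel_measurable borel" and c_nonzero: "c \<noteq> 0"
  shows "(\<integral>\<^sup>+w\<in>convex hull (corner_vertices v c). g (One \<bullet> w) \<partial>lborel) =
    ennreal (\<bar>c\<bar> ^ DIM('a)) *
      (\<integral>\<^sup>+r\<in>{0..1}. g (One \<bullet> v + c * r) * ennreal (divided_power (DIM('a) - 1) r) \<partial>lborel)"
proof -
  let ?J = "convex hull (corner_vertices v c)"
  have [measurable]: "?J \<in> sets borel"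
    by (intro borel_closed finite_imp_closed_convex_hull finite_corner_vertices)
  have indicator_J: "(indicator ?J (v + c *\<^sub>R t) :: ennreal) = indicator (coord_simplex 1) t" for t
    using c_nonzero by (auto simp: convex_hull_corner_vertices split: split_indicator)
  have "(\<integral>\<^sup>+w\<in>?J. g (One \<bullet> w) \<partial>lborel)
      = ennreal (\<bar>c\<bar> ^ DIM('a)) * (\<integral>\<^sup>+t\<in>coord_simplex 1. g (One \<bullet> v + c * (One \<bullet> (t::'a))) \<partial>lborel)"
    using c_nonzero
    by (subst nn_integral_lborel_affine[where a=c and b=v]) (auto simp: indicator_J inner_add_right)
  then show ?thesis
    by (subst (asm) nn_integral_coord_simplex) auto
qed

subsection \<open>Slabs over a truncated cone\<close>

lemma nn_integral_Icc_eq_integral: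
  fixes f :: "real \<Rightarrow> real"
  assumes "continuous_on {a..b} f" "\<And>x. x \<in> {a..b} \<Longrightarrow> 0 \<le> f x"
  shows "(\<integral>\<^sup>+x\<in>{a..b}. ennreal (f x) \<partial>lborel) = ennreal (integral {a..b} f)"
  by (rule nn_integral_has_integral_lebesgue')
    (use assms in \<open>auto intro!: integrable_integral integrable_continuous_real\<close>)

lemma continuous_on_curried_compose:
  assumes "continuous_on UNIV (case_prod h)" "continuous_on A f" "continuous_on A g"
  shows "continuous_on A (\<lambda>x. h (f x) (g x))"
  using continuous_on_compose2[OF assms(1) continuous_on_Pair[OF assms(2,3)]] by simp

definition cone_slab ::
  "'a::euclidean_space set \<Rightarrow> ('a \<Rightarrow> real \<Rightarrow> real) \<Rightarrow> ('a \<Rightarrow> real \<Rightarrow> real) \<Rightarrow> ('a \<times> real \<times> real) set" where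
  "cone_slab J lo hi = {(x, y, z). 0 < z \<and> z \<le> 1 \<and> (1 / z) *\<^sub>R x \<in> J
     \<and> lo ((1 / z) *\<^sub>R x) z \<le> y \<and> y \<le> hi ((1 / z) *\<^sub>R x) z}"

lemma emeasure_lborel_iterated:
  fixes S :: "('a::euclidean_space \<times> real \<times> real) set"
  assumes "S \<in> sets borel"
  shows "emeasure lborel S = (\<integral>\<^sup>+z. \<integral>\<^sup>+x. \<integral>\<^sup>+y. indicator S (x, y, z) \<partial>lborel \<partial>lborel \<partial>lborel)"
proof -
  have [measurable]: "S \<in> sets (borel \<Otimes>\<^sub>M borel \<Otimes>\<^sub>M borel)"
    using assms unfolding borel_prod .
  interpret pair_sigma_finite "lborel :: 'a measure" "lborel \<Otimes>\<^sub>M lborel :: (real \<times> real) measure"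
    unfolding lborel_prod by (rule lborel_pair.pair_sigma_finite_axioms)
  have "emeasure lborel S = (\<integral>\<^sup>+p. indicator S p \<partial>(lborel \<Otimes>\<^sub>M (lborel \<Otimes>\<^sub>M lborel)))"
    using assms unfolding lborel_prod by simp
  also have "\<dots> = (\<integral>\<^sup>+q. \<integral>\<^sup>+x. indicator S (x, q) \<partial>lborel \<partial>(lborel \<Otimes>\<^sub>M lborel))"
    by (rule nn_integral_snd[symmetric]) measurable
  also have "\<dots> = (\<integral>\<^sup>+z. \<integral>\<^sup>+y. \<integral>\<^sup>+x. indicator S (x, y, z) \<partial>lborel \<partial>lborel \<partial>lborel)"
    by (rule lborel_pair.nn_integral_snd[symmetric]) measurable
  also have "\<dots> = (\<integral>\<^sup>+z. \<integral>\<^sup>+x. \<integral>\<^sup>+y. indicator S (x, y, z) \<partial>lborel \<partial>lborel \<partial>lborel)"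
    by (intro nn_integral_cong lborel_pair.Fubini') measurable
  finally show ?thesis .
qed

context
  fixes J :: "'a::euclidean_space set" and lo hi :: "'a \<Rightarrow> real \<Rightarrow> real"
  assumes closed_J: "closed J"
    and cont_lo: "continuous_on UNIV (case_prod lo)" and cont_hi: "continuous_on UNIV (case_prod hi)"
begin

lemma closedin_cone_slab: "closedin (top_of_set {(x, y, z). 0 < z}) (cone_slab J lo hi)"
proof -
  let ?U = "{(x, y, z). 0 < z} :: ('a \<times> real \<times> real) set"
  define w where "w p = (1 / snd (snd p)) *\<^sub>R fst p" for p :: "'a \<times> real \<times> real"
  define F where "F p = (w p, snd (snd p), fst (snd p) - lo (w p) (snd (snd p)),
      hi (w p) (snd (snd p)) - fst (snd p))" for p
  have cont_w: "continuous_on ?U w"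
    unfolding w_def by (intro continuous_intros) auto
  have "continuous_on ?U F"
    unfolding F_def
    by (intro continuous_intros cont_w continuous_on_curried_compose[OF cont_lo]
        continuous_on_curried_compose[OF cont_hi])
  moreover have "closed (J \<times> {..1} \<times> {0..} \<times> {0..} :: ('a \<times> real \<times> real \<times> real) set)"
    by (intro closed_Times closed_J) auto
  ultimately have "closedin (top_of_set ?U) (?U \<inter> F -` (J \<times> {..1} \<times> {0..} \<times> {0..}))"
    by (rule continuous_closedin_preimage)
  moreover have "?U \<inter> F -` (J \<times> {..1} \<times> {0..} \<times> {0..}) = cone_slab J lo hi"
    by (auto simp: F_def w_def cone_slab_def)
  ultimately show ?thesis by simp
qed

lemma cone_slab_in_borel: "cone_slab J lo hi \<in> sets borel"
proof -
  obtain T where "closed T" "cone_slab J lo hi = {(x, y, z). 0 < z} \<inter> T"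
    using closedin_cone_slab by (auto simp: closedin_closed)
  moreover have "open ({(x, y, z). 0 < z} :: ('a \<times> real \<times> real) set)"
    unfolding split_beta by (intro open_Collect_less continuous_intros)
  ultimately show ?thesis
    by (simp add: sets.Int borel_open borel_closed)
qed

lemma closure_cone_slab_subset: "closure (cone_slab J lo hi) \<subseteq> cone_slab J lo hi \<union> {(x, y, z). z = 0}"
proof -
  obtain T where "closed T" and slab_eq: "cone_slab J lo hi = {(x, y, z). 0 < z} \<inter> T"
    using closedin_cone_slab by (auto simp: closedin_closed)
  have "closed ({(x, y, z). 0 \<le> z} :: ('a \<times> real \<times> real) set)"
    unfolding split_beta by (intro closed_Collect_le continuous_intros)
  with \<open>closed T\<close> have "closure (cone_slab J lo hi) \<subseteq> {(x, y, z). 0 \<le> z} \<inter> T"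
    by (intro closure_minimal closed_Int) (auto simp: slab_eq)
  with slab_eq show ?thesis by force
qed

lemma emeasure_cone_slab:
  "emeasure lborel (cone_slab J lo hi) =
     (\<integral>\<^sup>+z\<in>{0<..1}. ennreal (z ^ DIM('a)) * (\<integral>\<^sup>+w\<in>J. ennreal (hi w z - lo w z) \<partial>lborel) \<partial>lborel)"
proof -
  define G where "G z w = ennreal (hi w z - lo w z) * indicator J w" for z w
  have [measurable]: "G z \<in> borel_measurable borel" for z
  proof -
    have "(\<lambda>w. hi w z - lo w z) \<in> borel_measurable borel"
      by (intro borel_measurable_continuous_onI continuous_intros
          continuous_on_curried_compose[OF cont_lo] continuous_on_curried_compose[OF cont_hi])
    then show ?thesis
      using closed_J unfolding G_def by (measurable, auto)
  qed
  have slice: "(\<integral>\<^sup>+y. indicator (cone_slab J lo hi) (x, y, z) \<partial>lborel)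
      = G z ((1 / z) *\<^sub>R x) * indicator {0<..1} z" for x z
  proof -
    let ?w = "(1 / z) *\<^sub>R x"
    have "(\<integral>\<^sup>+y. indicator (cone_slab J lo hi) (x, y, z) \<partial>lborel)
        = (\<integral>\<^sup>+y. indicator {lo ?w z..hi ?w z} y * (indicator J ?w * indicator {0<..1} z) \<partial>lborel)"
      by (intro nn_integral_cong) (auto simp: cone_slab_def split: split_indicator)
    also have "\<dots> = ennreal (hi ?w z - lo ?w z) * (indicator J ?w * indicator {0<..1} z)"
      by (subst nn_integral_multc) (auto simp: emeasure_lborel_Icc_eq ennreal_neg)
    finally show ?thesis by (simp add: G_def mult.assoc)
  qed
  have dilate: "(\<integral>\<^sup>+x. G z ((1 / z) *\<^sub>R x) \<partial>lborel) = ennreal (z ^ DIM('a)) * (\<integral>\<^sup>+w. G z w \<partial>lborel)"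
    if "0 < z" for z
    using that by (subst nn_integral_lborel_affine[where a=z and b=0]) auto
  have "emeasure lborel (cone_slab J lo hi)
      = (\<integral>\<^sup>+z. (\<integral>\<^sup>+x. G z ((1 / z) *\<^sub>R x) \<partial>lborel) * indicator {0<..1} z \<partial>lborel)"
    unfolding emeasure_lborel_iterated[OF cone_slab_in_borel] slice
    by (intro nn_integral_cong nn_integral_multc) measurable
  also have "\<dots> = (\<integral>\<^sup>+z\<in>{0<..1}. ennreal (z ^ DIM('a)) * (\<integral>\<^sup>+w. G z w \<partial>lborel) \<partial>lborel)"
    by (intro nn_integral_cong) (auto simp: dilate split: split_indicator)
  finally show ?thesis unfolding G_def .
qed

lemma measure_cone_slab:
  assumes slice: "\<And>z. z \<in> {0..1} \<Longrightarrow> (\<integral>\<^sup>+w\<in>J. ennreal (hi w z - lo w z) \<partial>lborel) = ennreal (A z)"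
    and cont_A: "continuous_on {0..1} A" and A_nonneg: "\<And>z. z \<in> {0..1} \<Longrightarrow> 0 \<le> A z"
  shows "measure lborel (cone_slab J lo hi) = integral {0..1} (\<lambda>z. z ^ DIM('a) * A z)"
proof -
  have cont_integrand: "continuous_on {0..1} (\<lambda>z. z ^ DIM('a) * A z)"
    by (intro continuous_intros cont_A)
  have "emeasure lborel (cone_slab J lo hi) = (\<integral>\<^sup>+z\<in>{0..1}. ennreal (z ^ DIM('a) * A z) \<partial>lborel)"
    unfolding emeasure_cone_slab
  proof (rule nn_integral_cong)
    fix z :: real
    show "ennreal (z ^ DIM('a)) * (\<integral>\<^sup>+w\<in>J. ennreal (hi w z - lo w z) \<partial>lborel) * indicator {0<..1} z
        = ennreal (z ^ DIM('a) * A z) * indicator {0..1} z"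
      using slice[of z] A_nonneg[of z] by (cases "z = 0") (auto simp: ennreal_mult' split: split_indicator)
  qed
  also have "\<dots> = ennreal (integral {0..1} (\<lambda>z. z ^ DIM('a) * A z))"
    by (rule nn_integral_Icc_eq_integral[OF cont_integrand]) (use A_nonneg in auto)
  finally have "emeasure lborel (cone_slab J lo hi) = ennreal (integral {0..1} (\<lambda>z. z ^ DIM('a) * A z))" .
  moreover have "0 \<le> integral {0..1} (\<lambda>z. z ^ DIM('a) * A z)"
    by (intro integral_nonneg integrable_continuous_real cont_integrand) (use A_nonneg in auto)
  ultimately show ?thesis
    by (simp add: measure_def)
qed

end

lemma null_sets_third_eq_zero:
  "{(x, y, z). z = 0} \<in> null_sets (lborel :: ('a::euclidean_space \<times> real \<times> real) measure)"
proof -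
  have eq_hyperplane: "{(x, y, z). z = 0} = {p :: 'a \<times> real \<times> real. (0, 0, 1) \<bullet> p = 0}"
    by (auto simp: inner_prod_def)
  have "negligible {p :: 'a \<times> real \<times> real. (0, 0, 1) \<bullet> p = 0}"
    by (rule negligible_hyperplane) (simp add: zero_prod_def)
  moreover have "{p :: 'a \<times> real \<times> real. (0, 0, 1) \<bullet> p = 0} \<in> sets borel"
    by (intro borel_closed closed_hyperplane)
  ultimately show ?thesis
    unfolding eq_hyperplane by (simp add: negligible_iff_null_sets null_sets_completion_iff)
qed

lemma measure_eq_if_diff_third_eq_zero:
  fixes A S :: "('a::euclidean_space \<times> real \<times> real) set"
  assumes "A \<in> sets borel" "S \<in> sets borel" "A \<subseteq> S" "S \<subseteq> A \<union> {(x, y, z). z = 0}"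
  shows "measure lborel S = measure lborel A"
proof (rule measure_eq_AE)
  show "AE p in lborel. p \<in> S \<longleftrightarrow> p \<in> A"
    using AE_not_in[OF null_sets_third_eq_zero] by (rule eventually_mono) (use assms(3,4) in blast)
qed (use assms in simp_all)

subsection \<open>The two relaxations as slabs\<close>

lemma persp_mu_eq_scaled_affine_interp:
  assumes "affine_interp f V = (\<lambda>x. a \<bullet> x + b)" "z \<noteq> 0"
  shows "persp_mu f V x z = z * affine_interp f V ((1 / z) *\<^sub>R x)"
  using assms by (simp add: persp_mu_def algebra_simps)

lemma mem_scaleR_image_iff:
  fixes x :: "'a::real_vector"
  assumes "z \<noteq> 0"
  shows "x \<in> (\<lambda>w. z *\<^sub>R w) ` J \<longleftrightarrow> (1 / z) *\<^sub>R x \<in> J"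
  using assms by (force simp: image_iff)

lemma naive_relax_eq_cone_slab:
  assumes "affine_interp f V = (\<lambda>x. a \<bullet> x + b)" "V \<noteq> {}" "f 0 = 0"
  shows "naive_relax f V =
    insert (0, 0, 0) (cone_slab (convex hull V) (\<lambda>w z. f (z *\<^sub>R w)) (\<lambda>w z. z * affine_interp f V w))"
    (is "_ = insert _ ?S")
proof -
  have "(x, y, z) \<in> naive_relax f V \<longleftrightarrow> (x, y, z) \<in> insert (0, 0, 0) ?S" for x y z
  proof -
    consider (neg) "z < 0" | (zero) "z = 0" | (pos) "0 < z" by linarith
    then show ?thesis
    proof cases
      case zero
      then have "(\<lambda>w. z *\<^sub>R w) ` (convex hull V) = {0}"
        using \<open>V \<noteq> {}\<close> by (simp add: image_constant_conv)
      with zero \<open>f 0 = 0\<close> show ?thesis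
        by (auto simp: naive_relax_def cone_slab_def persp_mu_def)
    next
      case pos
      then show ?thesis
        by (simp add: naive_relax_def cone_slab_def mem_scaleR_image_iff
            persp_mu_eq_scaled_affine_interp[OF assms(1)]) blast
    qed (auto simp: naive_relax_def cone_slab_def)
  qed
  then show ?thesis by auto
qed

lemma persp_relax_eq_closure_cone_slab:
  assumes "affine_interp f V = (\<lambda>x. a \<bullet> x + b)"
  shows "persp_relax f V =
    closure (cone_slab (convex hull V) (\<lambda>w z. z * f w) (\<lambda>w z. z * affine_interp f V w))"
proof -
  have "z * f ((1 / z) *\<^sub>R x) \<le> y \<and> y \<le> persp_mu f V x z \<and> x \<in> (\<lambda>w. z *\<^sub>R w) ` (convex hull V)
      \<longleftrightarrow> (1 / z) *\<^sub>R x \<in> convex hull V \<and> z * f ((1 / z) *\<^sub>R x) \<le> y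
        \<and> y \<le> z * affine_interp f V ((1 / z) *\<^sub>R x)" if "0 < z" for x y z
    using that by (simp only: mem_scaleR_image_iff persp_mu_eq_scaled_affine_interp[OF assms]) blast
  then show ?thesis
    unfolding persp_relax_def cone_slab_def by (intro arg_cong[where f=closure]) blast
qed

lemma measure_naive_relax_eq_cone_slab:
  assumes "affine_interp f V = (\<lambda>x. a \<bullet> x + b)" "finite V" "V \<noteq> {}" "f 0 = 0" "continuous_on UNIV f"
  shows "measure lborel (naive_relax f V) =
    measure lborel (cone_slab (convex hull V) (\<lambda>w z. f (z *\<^sub>R w)) (\<lambda>w z. z * affine_interp f V w))"
    (is "_ = measure lborel ?S")
proof -
  have "closed (convex hull V)"
    by (intro finite_imp_closed_convex_hull assms)
  moreover have "continuous_on UNIV (\<lambda>(w, z). f (z *\<^sub>R w))"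
      "continuous_on UNIV (\<lambda>(w, z). z * affine_interp f V w)"
    unfolding assms(1) split_beta
    by (intro continuous_intros continuous_on_compose2[OF assms(5)] subset_UNIV)+
  ultimately have "?S \<in> sets borel"
    by (rule cone_slab_in_borel)
  then show ?thesis
    unfolding naive_relax_eq_cone_slab[OF assms(1,3,4)]
    by (intro measure_eq_if_diff_third_eq_zero) auto
qed

lemma measure_persp_relax_eq_cone_slab:
  assumes "affine_interp f V = (\<lambda>x. a \<bullet> x + b)" "finite V" "continuous_on UNIV f"
  shows "measure lborel (persp_relax f V) =
    measure lborel (cone_slab (convex hull V) (\<lambda>w z. z * f w) (\<lambda>w z. z * affine_interp f V w))"
proof -
  have closed: "closed (convex hull V)"
    by (intro finite_imp_closed_convex_hull assms)
  have cont: "continuous_on UNIV (\<lambda>(w, z). z * f w)"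
      "continuous_on UNIV (\<lambda>(w, z). z * affine_interp f V w)"
    unfolding assms(1) split_beta
    by (intro continuous_intros continuous_on_compose2[OF assms(3)] subset_UNIV)+
  show ?thesis
    unfolding persp_relax_eq_closure_cone_slab[OF assms(1)]
    by (rule measure_eq_if_diff_third_eq_zero[OF cone_slab_in_borel[OF closed cont] _ closure_subset
      closure_cone_slab_subset[OF closed cont]]) simp
qed

subsection \<open>Ridge functions over a corner simplex\<close>

lemma affine_hull_corner_vertices:
  fixes v :: "'a::euclidean_space"
  assumes "c \<noteq> 0"
  shows "affine hull (corner_vertices v c) = UNIV"
proof -
  have "span ((\<lambda>b. c *\<^sub>R b) ` Basis) = (UNIV :: 'a set)"
    using assms span_image_scale[of "Basis :: 'a set" "\<lambda>_. c"] by simp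
  then have "affine hull (corner_vertices v c) = range ((+) v)"
    unfolding corner_vertices_def affine_hull_insert_span_gen by (simp add: image_image)
  then show ?thesis by simp
qed

lemma affine_interp_eqI:
  assumes g_affine: "g = (\<lambda>x. a \<bullet> x + b)" and g_agrees: "\<And>x. x \<in> V \<Longrightarrow> g x = f x"
    and hull_UNIV: "affine hull V = UNIV"
  shows "affine_interp f V = g"
  unfolding affine_interp_def
proof (rule the_equality)
  show "(\<exists>a b. g = (\<lambda>x. a \<bullet> x + b)) \<and> (\<forall>x\<in>V. g x = f x)"
    using g_affine g_agrees by blast
  fix h assume "(\<exists>a b. h = (\<lambda>x. a \<bullet> x + b)) \<and> (\<forall>x\<in>V. h x = f x)"
  then obtain a' b' where h_affine: "h = (\<lambda>x. a' \<bullet> x + b')" and "\<forall>x\<in>V. h x = f x"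
    by blast
  then have "V \<subseteq> {x. (a' - a) \<bullet> x = b - b'}"
    using g_agrees unfolding g_affine h_affine by (force simp: inner_diff_left)
  then have "affine hull V \<subseteq> {x. (a' - a) \<bullet> x = b - b'}"
    by (intro hull_minimal affine_hyperplane)
  then show "h = g"
    unfolding hull_UNIV g_affine h_affine by (auto simp: inner_diff_left algebra_simps subset_iff)
qed

definition chord :: "(real \<Rightarrow> real) \<Rightarrow> real \<Rightarrow> real \<Rightarrow> real \<Rightarrow> real" where
  "chord \<phi> s c a = \<phi> s + (\<phi> (s + c) - \<phi> s) / c * (a - s)"

lemma chord_eq: "c \<noteq> 0 \<Longrightarrow> chord \<phi> s c (s + c * r) = \<phi> s + (\<phi> (s + c) - \<phi> s) * r"
  by (simp add: chord_def)

lemma chord_inner_eq_affine: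
  "(\<lambda>x. chord \<phi> s c (y \<bullet> x)) =
    (\<lambda>x. (((\<phi> (s + c) - \<phi> s) / c) *\<^sub>R y) \<bullet> x + (\<phi> s - (\<phi> (s + c) - \<phi> s) / c * s))"
  by (simp add: chord_def fun_eq_iff right_diff_distrib)

lemma continuous_on_chord [continuous_intros]:
  "continuous_on A f \<Longrightarrow> continuous_on A (\<lambda>x. chord \<phi> s c (f x))"
  unfolding chord_def by (intro continuous_intros)

lemma convex_on_le_chord:
  assumes "convex_on UNIV \<phi>" "c \<noteq> 0" "0 \<le> r" "r \<le> 1"
  shows "\<phi> (s + c * r) \<le> chord \<phi> s c (s + c * r)"
  using convex_onD[OF assms(1,3,4), of s "s + c"] assms(2) by (simp add: chord_eq algebra_simps)

lemma convex_on_scaleR_le: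
  fixes g :: "'a::real_vector \<Rightarrow> real"
  assumes "convex_on UNIV g" "g 0 = 0" "0 \<le> z" "z \<le> 1"
  shows "g (z *\<^sub>R x) \<le> z * g x"
  using convex_onD[OF assms(1,3,4), of 0 x] assms(2) by simp

lemma affine_interp_ridge_corner:
  fixes v :: "real^'n"
  assumes "c \<noteq> 0"
  shows "affine_interp (\<lambda>x. \<phi> (One \<bullet> x)) (corner_vertices v c) = (\<lambda>x. chord \<phi> (One \<bullet> v) c (One \<bullet> x))"
proof (rule affine_interp_eqI[OF chord_inner_eq_affine])
  have "(One :: real^'n) \<bullet> b = 1" if "b \<in> Basis" for b
    using that by (simp add: inner_sum_left inner_Basis)
  then show "chord \<phi> (One \<bullet> v) c (One \<bullet> x) = \<phi> (One \<bullet> x)" if "x \<in> corner_vertices v c" for x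
    using that assms by (auto simp: corner_vertices_def inner_add_right chord_def)
qed (rule affine_hull_corner_vertices[OF assms])

lemma continuous_on_integral_divided_power:
  fixes \<psi> :: "real \<Rightarrow> real \<Rightarrow> real"
  assumes "continuous_on UNIV (case_prod \<psi>)"
  shows "continuous_on UNIV (\<lambda>z. integral {0..1} (\<lambda>r. \<psi> r z * divided_power m r))"
  unfolding box_real(2)[symmetric]
  by (rule integral_continuous_on_param, unfold split_beta)
    (intro continuous_intros continuous_on_curried_compose[OF assms])

lemma nn_integral_ridge_corner:
  fixes v :: "'a::euclidean_space" and h :: "real \<Rightarrow> real"
  assumes c_nonzero: "c \<noteq> 0" and DIM_eq: "DIM('a) = Suc m" and cont_h: "continuous_on UNIV h"
    and h_nonneg: "\<And>r. r \<in> {0..1} \<Longrightarrow> 0 \<le> h (One \<bullet> v + c * r)"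
  shows "(\<integral>\<^sup>+w\<in>convex hull (corner_vertices v c). ennreal (h (One \<bullet> w)) \<partial>lborel)
    = ennreal (\<bar>c\<bar> ^ Suc m * integral {0..1} (\<lambda>r. h (One \<bullet> v + c * r) * divided_power m r))"
    (is "?I = ennreal (_ * integral _ ?g)")
proof -
  have [measurable]: "h \<in> borel_measurable borel"
    by (rule borel_measurable_continuous_onI[OF cont_h])
  have g_cont_nonneg: "continuous_on {0..1} ?g" "\<And>r. r \<in> {0..1} \<Longrightarrow> 0 \<le> ?g r"
    by (auto intro!: continuous_intros continuous_on_compose2[OF cont_h] mult_nonneg_nonneg
        h_nonneg divided_power_nonneg)
  have "?I = ennreal (\<bar>c\<bar> ^ Suc m) *
      (\<integral>\<^sup>+r\<in>{0..1}. ennreal (h (One \<bullet> v + c * r)) * ennreal (divided_power m r) \<partial>lborel)"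
    by (subst nn_integral_corner[where g="\<lambda>a. ennreal (h a)"]) (use c_nonzero in \<open>simp_all add: DIM_eq\<close>)
  also have "(\<integral>\<^sup>+r\<in>{0..1}. ennreal (h (One \<bullet> v + c * r)) * ennreal (divided_power m r) \<partial>lborel)
      = (\<integral>\<^sup>+r\<in>{0..1}. ennreal (?g r) \<partial>lborel)"
    by (intro nn_integral_cong)
      (auto simp: h_nonneg divided_power_nonneg split: split_indicator simp flip: ennreal_mult)
  also have "\<dots> = ennreal (integral {0..1} ?g)"
    by (rule nn_integral_Icc_eq_integral[OF g_cont_nonneg])
  finally show ?thesis
    by (simp add: ennreal_mult' del: power_Suc)
qed

lemma measure_ridge_slab:
  fixes v :: "'a::euclidean_space" and lo hi :: "real \<Rightarrow> real \<Rightarrow> real"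
  assumes c_nonzero: "c \<noteq> 0" and DIM_eq: "DIM('a) = Suc m"
    and cont_lo: "continuous_on UNIV (case_prod lo)" and cont_hi: "continuous_on UNIV (case_prod hi)"
    and lo_le_hi: "\<And>r z. r \<in> {0..1} \<Longrightarrow> z \<in> {0..1} \<Longrightarrow> lo (One \<bullet> v + c * r) z \<le> hi (One \<bullet> v + c * r) z"
  shows "measure lborel (cone_slab (convex hull (corner_vertices v c)) (\<lambda>w. lo (One \<bullet> w)) (\<lambda>w. hi (One \<bullet> w))) =
    \<bar>c\<bar> ^ Suc m * integral {0..1} (\<lambda>z. z ^ Suc m * integral {0..1} (\<lambda>r.
      (hi (One \<bullet> v + c * r) z - lo (One \<bullet> v + c * r) z) * divided_power m r))"
    (is "_ = _ * integral _ (\<lambda>z. _ * ?A z)")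
proof -
  let ?gap = "\<lambda>r z. hi (One \<bullet> v + c * r) z - lo (One \<bullet> v + c * r) z"
  have cont_gap: "continuous_on UNIV (\<lambda>(r, z). ?gap r z)"
    unfolding split_beta
    by (intro continuous_intros continuous_on_curried_compose[OF cont_lo]
        continuous_on_curried_compose[OF cont_hi])
  have cont_A: "continuous_on UNIV ?A"
    by (rule continuous_on_integral_divided_power[OF cont_gap])
  have A_nonneg: "0 \<le> ?A z" if "z \<in> {0..1}" for z
    using lo_le_hi that
    by (intro integral_nonneg integrable_continuous_real continuous_intros
        continuous_on_curried_compose[OF cont_gap]) (auto simp: divided_power_nonneg)
  have "measure lborel (cone_slab (convex hull (corner_vertices v c)) (\<lambda>w. lo (One \<bullet> w)) (\<lambda>w. hi (One \<bullet> w)))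
      = integral {0..1} (\<lambda>z. z ^ DIM('a) * (\<bar>c\<bar> ^ Suc m * ?A z))"
  proof (rule measure_cone_slab)
    show "closed (convex hull (corner_vertices v c))"
      by (intro finite_imp_closed_convex_hull finite_corner_vertices)
    show "continuous_on UNIV (\<lambda>(w::'a, z). lo (One \<bullet> w) z)" "continuous_on UNIV (\<lambda>(w::'a, z). hi (One \<bullet> w) z)"
      unfolding split_beta
      by (intro continuous_intros continuous_on_curried_compose[OF cont_lo]
          continuous_on_curried_compose[OF cont_hi])+
    show "(\<integral>\<^sup>+w\<in>convex hull (corner_vertices v c). ennreal (hi (One \<bullet> w) z - lo (One \<bullet> w) z) \<partial>lborel)
        = ennreal (\<bar>c\<bar> ^ Suc m * ?A z)" if "z \<in> {0..1}" for z
      by (rule nn_integral_ridge_corner[OF c_nonzero DIM_eq])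
        (use lo_le_hi that in \<open>auto intro!: continuous_intros
          continuous_on_curried_compose[OF cont_lo] continuous_on_curried_compose[OF cont_hi]\<close>)
  qed (auto intro!: continuous_intros continuous_on_subset[OF cont_A] A_nonneg mult_nonneg_nonneg
      simp del: power_Suc)
  then show ?thesis
    unfolding DIM_eq mult.left_commute[of _ "\<bar>c\<bar> ^ Suc m"] integral_mult_right .
qed

lemma has_integral_divided_power: "(divided_power m has_integral 1 / fact (Suc m)) {0..1}"
proof -
  have "(divided_power m has_integral divided_power (Suc m) 1 - divided_power (Suc m) 0) {0..1}"
    by (rule fundamental_theorem_of_calculus)
      (use has_real_derivative_divided_power in \<open>auto simp flip: has_real_derivative_iff_has_vector_derivative\<close>)
  then show ?thesis by (simp add: divided_power_def)
qed

lemma has_integral_power: "((\<lambda>z::real. z ^ m) has_integral 1 / real (Suc m)) {0..1}"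
  using has_integral_mult_right[OF has_integral_divided_power[of m], of "fact m"]
  by (simp add: divided_power_def)

definition chord_integral :: "nat \<Rightarrow> (real \<Rightarrow> real) \<Rightarrow> real \<Rightarrow> real \<Rightarrow> real" where
  "chord_integral m \<phi> s c = (\<phi> s + real (Suc m) * \<phi> (s + c)) / fact (Suc (Suc m))"

lemma has_integral_chord:
  assumes "c \<noteq> 0"
  shows "((\<lambda>r. chord \<phi> s c (s + c * r) * divided_power m r) has_integral chord_integral m \<phi> s c) {0..1}"
proof -
  let ?\<delta> = "real (Suc m) * (\<phi> (s + c) - \<phi> s)"
  have "((\<lambda>r. \<phi> s * divided_power m r + ?\<delta> * divided_power (Suc m) r) has_integral
      \<phi> s * (1 / fact (Suc m)) + ?\<delta> * (1 / fact (Suc (Suc m)))) {0..1}"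
    by (intro has_integral_add has_integral_mult_right has_integral_divided_power)
  moreover have "\<phi> s * divided_power m r + ?\<delta> * divided_power (Suc m) r
      = chord \<phi> s c (s + c * r) * divided_power m r" for r
    using assms by (simp add: chord_eq divided_power_def field_simps del: of_nat_Suc)
  moreover have "\<phi> s * (1 / fact (Suc m)) + ?\<delta> * (1 / fact (Suc (Suc m))) = chord_integral m \<phi> s c"
  proof -
    have "1 / fact (Suc m) = real (Suc (Suc m)) / (fact (Suc (Suc m)) :: real)"
      by simp
    then show ?thesis
      unfolding chord_integral_def
      by (simp only:) (simp add: algebra_simps add_divide_distrib diff_divide_distrib del: fact_Suc)
  qed
  ultimately show ?thesis by (simp del: fact_Suc of_nat_Suc)
qed

lemma measure_slab_below_chord:
  fixes v :: "'a::euclidean_space"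
  defines "s \<equiv> One \<bullet> v"
  assumes c_nonzero: "c \<noteq> 0" and DIM_eq: "DIM('a) = Suc m" and cont_\<psi>: "continuous_on UNIV (case_prod \<psi>)"
    and \<psi>_le_chord: "\<And>r z. r \<in> {0..1} \<Longrightarrow> z \<in> {0..1} \<Longrightarrow> \<psi> (s + c * r) z \<le> z * chord \<phi> s c (s + c * r)"
  shows "measure lborel (cone_slab (convex hull (corner_vertices v c))
      (\<lambda>w. \<psi> (One \<bullet> w)) (\<lambda>w z. z * chord \<phi> s c (One \<bullet> w))) =
    \<bar>c\<bar> ^ Suc m * (chord_integral m \<phi> s c / real (m + 3)
      - integral {0..1} (\<lambda>z. z ^ Suc m * integral {0..1} (\<lambda>r. \<psi> (s + c * r) z * divided_power m r)))"
proof -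
  let ?C = "chord_integral m \<phi> s c"
  let ?\<Psi> = "\<lambda>z. integral {0..1} (\<lambda>r. \<psi> (s + c * r) z * divided_power m r)"
  have cont_\<psi>_affine: "continuous_on UNIV (\<lambda>(r, z). \<psi> (s + c * r) z)"
    unfolding split_beta by (intro continuous_intros continuous_on_curried_compose[OF cont_\<psi>])
  have integral_chord_minus_\<psi>:
    "integral {0..1} (\<lambda>r. (z * chord \<phi> s c (s + c * r) - \<psi> (s + c * r) z) * divided_power m r)
      = z * ?C - ?\<Psi> z" for z
  proof -
    have "((\<lambda>r. z * (chord \<phi> s c (s + c * r) * divided_power m r) - \<psi> (s + c * r) z * divided_power m r)
        has_integral z * ?C - ?\<Psi> z) {0..1}"
      by (intro has_integral_diff has_integral_mult_right has_integral_chord c_nonzero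
          integrable_integral integrable_continuous_real continuous_intros
          continuous_on_curried_compose[OF cont_\<psi>_affine])
    then show ?thesis
      by (intro integral_unique) (simp add: left_diff_distrib mult.assoc)
  qed
  have "((\<lambda>z. ?C * z ^ Suc (Suc m) - z ^ Suc m * ?\<Psi> z) has_integral
      ?C * (1 / real (Suc (Suc (Suc m)))) - integral {0..1} (\<lambda>z. z ^ Suc m * ?\<Psi> z)) {0..1}"
    by (intro has_integral_diff has_integral_mult_right has_integral_power
        integrable_integral integrable_continuous_real continuous_intros
        continuous_on_subset[OF continuous_on_integral_divided_power[OF cont_\<psi>_affine]]) auto
  then have "integral {0..1} (\<lambda>z. z ^ Suc m * (z * ?C - ?\<Psi> z)) =
      ?C / real (m + 3) - integral {0..1} (\<lambda>z. z ^ Suc m * ?\<Psi> z)"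
    by (intro integral_unique) (simp add: right_diff_distrib mult_ac eval_nat_numeral del: of_nat_Suc fact_Suc)
  then show ?thesis
    using measure_ridge_slab[OF c_nonzero DIM_eq cont_\<psi>, of "\<lambda>a z. z * chord \<phi> s c a" v] \<psi>_le_chord
    unfolding s_def integral_chord_minus_\<psi>[unfolded s_def]
    by (simp add: split_beta continuous_intros)
qed

definition ridge_integral :: "nat \<Rightarrow> (real \<Rightarrow> real) \<Rightarrow> real \<Rightarrow> real \<Rightarrow> real" where
  "ridge_integral m \<phi> s c = integral {0..1} (\<lambda>r. \<phi> (s + c * r) * divided_power m r)"

definition cone_ridge_integral :: "nat \<Rightarrow> (real \<Rightarrow> real) \<Rightarrow> real \<Rightarrow> real \<Rightarrow> real" where
  "cone_ridge_integral m \<phi> s c = integral {0..1} (\<lambda>z. z ^ Suc m * ridge_integral m \<phi> (z * s) (z * c))"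

lemma has_integral_ridge_integral:
  assumes "continuous_on UNIV \<phi>"
  shows "((\<lambda>r. \<phi> (s + c * r) * divided_power m r) has_integral ridge_integral m \<phi> s c) {0..1}"
  unfolding ridge_integral_def
  by (intro integrable_integral integrable_continuous_real continuous_intros
      continuous_on_compose2[OF assms] subset_UNIV)

lemma has_integral_cone_ridge_integral:
  assumes "continuous_on UNIV \<phi>"
  shows "((\<lambda>z. z ^ Suc m * ridge_integral m \<phi> (z * s) (z * c)) has_integral
    cone_ridge_integral m \<phi> s c) {0..1}"
proof -
  have "continuous_on UNIV (\<lambda>(r, z). \<phi> (z * s + z * c * r))"
    unfolding split_beta by (intro continuous_on_compose2[OF assms] continuous_intros) auto
  then have "continuous_on UNIV (\<lambda>z. ridge_integral m \<phi> (z * s) (z * c))"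
    unfolding ridge_integral_def by (rule continuous_on_integral_divided_power)
  then show ?thesis
    unfolding cone_ridge_integral_def
    by (intro integrable_integral integrable_continuous_real continuous_intros)
      (rule continuous_on_subset, auto)
qed

context
  fixes \<phi> :: "real \<Rightarrow> real" and v :: "real^'n" and c :: real and m :: nat
  assumes convex_\<phi>: "convex_on UNIV \<phi>" and cont_\<phi>: "continuous_on UNIV \<phi>" and \<phi>_0: "\<phi> 0 = 0"
    and c_nonzero: "c \<noteq> 0" and CARD_eq: "CARD('n) = Suc m"
begin

private abbreviation (input) "s \<equiv> One \<bullet> v"
private abbreviation (input) "f \<equiv> \<lambda>x. \<phi> (One \<bullet> x)"
private abbreviation (input) "V \<equiv> corner_vertices v c"
private abbreviation (input) "C \<equiv> chord_integral m \<phi> s c"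

private lemmas affine_interp_eq = affine_interp_ridge_corner[OF c_nonzero, of \<phi> v]

lemma measure_naive_relax_ridge_corner:
  "measure lborel (naive_relax f V) =
    \<bar>c\<bar> ^ Suc m * (C / real (m + 3) - cone_ridge_integral m \<phi> s c)"
proof -
  have "measure lborel (naive_relax f V) = measure lborel (cone_slab (convex hull V)
      (\<lambda>w z. \<phi> (z * (One \<bullet> w))) (\<lambda>w z. z * chord \<phi> s c (One \<bullet> w)))"
    using measure_naive_relax_eq_cone_slab[OF trans[OF affine_interp_eq chord_inner_eq_affine]]
    by (simp add: affine_interp_eq finite_corner_vertices corner_vertices_nonempty \<phi>_0
        continuous_on_compose2[OF cont_\<phi>] continuous_intros)
  also have "\<dots> = \<bar>c\<bar> ^ Suc m * (C / real (m + 3) - integral {0..1}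
      (\<lambda>z. z ^ Suc m * integral {0..1} (\<lambda>r. \<phi> (z * (s + c * r)) * divided_power m r)))"
  proof (rule measure_slab_below_chord[OF c_nonzero])
    show "\<phi> (z * (s + c * r)) \<le> z * chord \<phi> s c (s + c * r)" if "r \<in> {0..1}" "z \<in> {0..1}" for r z
    proof -
      have "\<phi> (z * (s + c * r)) \<le> z * \<phi> (s + c * r)"
        using convex_on_scaleR_le[OF convex_\<phi> \<phi>_0, of z "s + c * r"] that by simp
      also have "\<dots> \<le> z * chord \<phi> s c (s + c * r)"
        using that by (intro mult_left_mono convex_on_le_chord convex_\<phi> c_nonzero) auto
      finally show ?thesis .
    qed
  qed (use CARD_eq in \<open>auto simp: split_beta intro!: continuous_intros continuous_on_compose2[OF cont_\<phi>]\<close>)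
  finally show ?thesis
    by (simp add: cone_ridge_integral_def ridge_integral_def distrib_left mult.assoc)
qed

lemma measure_persp_relax_ridge_corner:
  "measure lborel (persp_relax f V) = \<bar>c\<bar> ^ Suc m * ((C - ridge_integral m \<phi> s c) / real (m + 3))"
proof -
  have scale: "integral {0..1} (\<lambda>r. z * \<phi> (s + c * r) * divided_power m r) = z * ridge_integral m \<phi> s c" for z
    by (simp add: ridge_integral_def mult.assoc)
  have "measure lborel (persp_relax f V) = measure lborel (cone_slab (convex hull V)
      (\<lambda>w z. z * \<phi> (One \<bullet> w)) (\<lambda>w z. z * chord \<phi> s c (One \<bullet> w)))"
    using measure_persp_relax_eq_cone_slab[OF trans[OF affine_interp_eq chord_inner_eq_affine]]
    by (simp add: affine_interp_eq finite_corner_vertices continuous_on_compose2[OF cont_\<phi>] continuous_intros)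
  also have "\<dots> = \<bar>c\<bar> ^ Suc m * (C / real (m + 3) - integral {0..1}
      (\<lambda>z. z ^ Suc m * integral {0..1} (\<lambda>r. z * \<phi> (s + c * r) * divided_power m r)))"
  proof (rule measure_slab_below_chord[OF c_nonzero])
    show "z * \<phi> (s + c * r) \<le> z * chord \<phi> s c (s + c * r)" if "r \<in> {0..1}" "z \<in> {0..1}" for r z
      using that by (intro mult_left_mono convex_on_le_chord convex_\<phi> c_nonzero) auto
  qed (use CARD_eq in \<open>auto simp: split_beta intro!: continuous_intros continuous_on_compose2[OF cont_\<phi>]\<close>)
  also have "integral {0..1} (\<lambda>z. z ^ Suc m * integral {0..1} (\<lambda>r. z * \<phi> (s + c * r) * divided_power m r))
      = ridge_integral m \<phi> s c / real (m + 3)"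
    unfolding scale
    using has_integral_mult_left[OF has_integral_power[of "Suc (Suc m)"], of "ridge_integral m \<phi> s c"]
    by (intro integral_unique) (simp add: mult_ac eval_nat_numeral del: of_nat_Suc)
  finally show ?thesis by (simp add: diff_divide_distrib)
qed

lemma rel_gap_ridge_corner:
  "rel_gap f V = (ridge_integral m \<phi> s c - real (m + 3) * cone_ridge_integral m \<phi> s c) /
    (C - real (m + 3) * cone_ridge_integral m \<phi> s c)"
proof -
  define n k R K D where "n = real (m + 3)" and "k = \<bar>c\<bar> ^ Suc m"
    and "R = ridge_integral m \<phi> s c" and "K = cone_ridge_integral m \<phi> s c" and "D = C"
  have "n \<noteq> 0" "k \<noteq> 0"
    using c_nonzero by (simp_all add: n_def k_def)
  have "k * (D / n - K) - k * ((D - R) / n) = k / n * (R - n * K)"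
      "k * (D / n - K) = k / n * (D - n * K)"
    using \<open>n \<noteq> 0\<close> by (simp_all add: field_simps)
  then have "(k * (D / n - K) - k * ((D - R) / n)) / (k * (D / n - K)) = (R - n * K) / (D - n * K)"
    using \<open>n \<noteq> 0\<close> \<open>k \<noteq> 0\<close> by simp
  then show ?thesis
    unfolding rel_gap_def measure_naive_relax_ridge_corner measure_persp_relax_ridge_corner
      n_def k_def R_def K_def D_def .
qed

end

subsection \<open>Exponential moments\<close>

definition exp_moment :: "nat \<Rightarrow> real \<Rightarrow> real" where
  "exp_moment m a = integral {0..1} (\<lambda>r. exp (a * r) * divided_power m r)"

lemma has_integral_exp_moment:
  "((\<lambda>r. exp (a * r) * divided_power m r) has_integral exp_moment m a) {0..1}"
  unfolding exp_moment_def
  by (intro integrable_integral integrable_continuous_real continuous_intros)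

lemma exp_moment_nonneg: "0 \<le> exp_moment m a"
  by (rule has_integral_nonneg[OF has_integral_exp_moment]) (simp add: divided_power_nonneg)

lemma mult_exp_moment_0: "a * exp_moment 0 a = exp a - 1"
proof -
  have "((\<lambda>r. a * (exp (a * r) * divided_power 0 r)) has_integral exp (a * 1) - exp (a * 0)) {0..1}"
    by (rule fundamental_theorem_of_calculus)
      (auto intro!: derivative_eq_intros simp: divided_power_def
        simp flip: has_real_derivative_iff_has_vector_derivative)
  moreover have "((\<lambda>r. a * (exp (a * r) * divided_power 0 r)) has_integral a * exp_moment 0 a) {0..1}"
    by (intro has_integral_mult_right has_integral_exp_moment)
  ultimately have "a * exp_moment 0 a = exp (a * 1) - exp (a * 0)"
    by (rule has_integral_unique[symmetric])
  then show ?thesis by simp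
qed

lemma mult_exp_moment_Suc:
  "a * exp_moment (Suc m) a = exp a / fact (Suc m) - exp_moment m a"
proof -
  let ?g = "\<lambda>r. a * (exp (a * r) * divided_power (Suc m) r) + exp (a * r) * divided_power m r"
  have "(?g has_integral exp (a * 1) * divided_power (Suc m) 1 - exp (a * 0) * divided_power (Suc m) 0) {0..1}"
  proof (rule fundamental_theorem_of_calculus)
    fix r :: real
    have "((\<lambda>r. exp (a * r)) has_real_derivative a * exp (a * r)) (at r within {0..1})"
      by (auto intro!: derivative_eq_intros)
    from DERIV_mult[OF this has_real_derivative_divided_power]
    show "((\<lambda>r. exp (a * r) * divided_power (Suc m) r) has_vector_derivative ?g r) (at r within {0..1})"
      unfolding has_real_derivative_iff_has_vector_derivative[symmetric] by (simp add: mult_ac)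
  qed simp
  moreover have "(?g has_integral a * exp_moment (Suc m) a + exp_moment m a) {0..1}"
    by (intro has_integral_add has_integral_mult_right has_integral_exp_moment)
  ultimately have "a * exp_moment (Suc m) a + exp_moment m a
      = exp (a * 1) * divided_power (Suc m) 1 - exp (a * 0) * divided_power (Suc m) 0"
    by (rule has_integral_unique[symmetric])
  then show ?thesis by (simp add: divided_power_def)
qed

lemma mult_exp_moment_le: "a * exp_moment m a \<le> exp a"
proof (cases m)
  case (Suc k)
  have "exp a / fact (Suc k) \<le> exp a"
    by (simp add: field_simps del: fact_Suc)
  then show ?thesis
    using exp_moment_nonneg[of k a] unfolding Suc mult_exp_moment_Suc by linarith
qed (simp add: mult_exp_moment_0)

lemma power_mult_exp_moment_uminus_0: "u ^ Suc 0 * exp_moment 0 (- u) = 1 - exp (- u)"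
  using mult_exp_moment_0[of "- u"] by simp

lemma power_mult_exp_moment_uminus_Suc:
  "u ^ Suc (Suc m) * exp_moment (Suc m) (- u) =
    u ^ Suc m * exp_moment m (- u) - u ^ Suc m * exp (- u) / fact (Suc m)"
  using mult_exp_moment_Suc[of "- u" m] by (simp add: algebra_simps)

lemma power_mult_exp_moment_uminus_le: "0 \<le> u \<Longrightarrow> u ^ Suc m * exp_moment m (- u) \<le> 1"
proof (induction m)
  case 0
  then show ?case unfolding power_mult_exp_moment_uminus_0 by simp
next
  case (Suc m)
  have "0 \<le> u ^ Suc m * exp (- u) / fact (Suc m)"
    using Suc.prems by simp
  then show ?case
    unfolding power_mult_exp_moment_uminus_Suc using Suc by linarith
qed

lemma power_mult_exp_moment_uminus_tendsto: "((\<lambda>u. u ^ Suc m * exp_moment m (- u)) \<longlongrightarrow> 1) at_top"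
proof (induction m)
  case 0
  have "((\<lambda>u::real. 1 - exp (- u)) \<longlongrightarrow> 1) at_top"
    by real_asymp
  then show ?case unfolding power_mult_exp_moment_uminus_0 .
next
  case (Suc m)
  have "((\<lambda>u::real. u ^ Suc m * exp (- u) / fact (Suc m)) \<longlongrightarrow> 0) at_top"
    by real_asymp
  from tendsto_diff[OF Suc.IH this] show ?case
    unfolding power_mult_exp_moment_uminus_Suc by simp
qed

lemma exp_moment_div_exp_tendsto_0: "((\<lambda>a. exp_moment m a / exp a) \<longlongrightarrow> 0) at_top"
proof (rule tendsto_sandwich[of "\<lambda>_. 0" _ _ "\<lambda>a. 1 / a"])
  show "\<forall>\<^sub>F a in at_top. exp_moment m a / exp a \<le> 1 / a"
    using eventually_gt_at_top[of "0::real"]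
    by eventually_elim (use mult_exp_moment_le in \<open>auto simp: field_simps\<close>)
  show "((\<lambda>a::real. 1 / a) \<longlongrightarrow> 0) at_top"
    by real_asymp
qed (auto simp: exp_moment_nonneg)

lemma mult_exp_moment_div_exp_tendsto: "((\<lambda>u. u * exp_moment m u / exp u) \<longlongrightarrow> 1 / fact m) at_top"
proof (cases m)
  case 0
  have "((\<lambda>u::real. (exp u - 1) / exp u) \<longlongrightarrow> 1) at_top"
    by real_asymp
  then show ?thesis by (simp add: 0 mult_exp_moment_0)
next
  case (Suc k)
  have "((\<lambda>u. 1 / fact m - exp_moment k u / exp u) \<longlongrightarrow> 1 / fact m - 0) at_top"
    by (intro tendsto_intros exp_moment_div_exp_tendsto_0)
  then show ?thesis
    by (simp add: Suc mult_exp_moment_Suc diff_divide_distrib del: fact_Suc)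
qed

lemma ridge_integral_exp: "ridge_integral m exp s c = exp s * exp_moment m c"
  by (simp add: ridge_integral_def exp_moment_def exp_add mult.assoc)

abbreviation cone_exp_moment :: "nat \<Rightarrow> real \<Rightarrow> real \<Rightarrow> real" where
  "cone_exp_moment m \<equiv> cone_ridge_integral m exp"

lemma has_integral_cone_exp_moment:
  "((\<lambda>z. z ^ Suc m * (exp (z * s) * exp_moment m (z * c))) has_integral cone_exp_moment m s c) {0..1}"
  using has_integral_cone_ridge_integral[of exp m s c]
  by (simp only: ridge_integral_exp continuous_intros)

lemma cone_exp_moment_nonneg: "0 \<le> cone_exp_moment m s c"
  by (rule has_integral_nonneg[OF has_integral_cone_exp_moment]) (simp add: exp_moment_nonneg)

lemma power_mult_cone_exp_moment_uminus_le:
  assumes "0 \<le> u"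
  shows "u ^ Suc m * cone_exp_moment m s (- u) \<le> exp_moment 0 s"
proof (rule has_integral_le[OF has_integral_mult_right[OF has_integral_cone_exp_moment] has_integral_exp_moment])
  fix z :: real assume "z \<in> {0..1}"
  then have "(z * u) ^ Suc m * exp_moment m (- (z * u)) * exp (z * s) \<le> 1 * exp (z * s)"
    using assms by (intro mult_right_mono power_mult_exp_moment_uminus_le) auto
  then show "u ^ Suc m * (z ^ Suc m * (exp (z * s) * exp_moment m (z * - u)))
      \<le> exp (s * z) * divided_power 0 z"
    unfolding power_mult_distrib by (simp add: divided_power_def mult_ac del: power_Suc)
qed

lemma mult_cone_exp_moment_le:
  assumes "0 \<le> u" "0 \<le> s"
  shows "u * cone_exp_moment m s u \<le> exp s * exp_moment 0 u"
proof (rule has_integral_le[OF has_integral_mult_right[OF has_integral_cone_exp_moment]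
      has_integral_mult_right[OF has_integral_exp_moment]])
  fix z :: real assume "z \<in> {0..1}"
  have "u * (z ^ Suc m * (exp (z * s) * exp_moment m (z * u)))
      = (z ^ m * exp (z * s)) * (z * u * exp_moment m (z * u))"
    by (simp add: mult_ac)
  also have "\<dots> \<le> (1 * exp s) * exp (z * u)"
    using \<open>z \<in> {0..1}\<close> assms
    by (intro mult_mono mult_exp_moment_le) (auto simp: power_le_one mult_left_le_one_le exp_moment_nonneg)
  finally show "u * (z ^ Suc m * (exp (z * s) * exp_moment m (z * u)))
      \<le> exp s * (exp (u * z) * divided_power 0 z)"
    by (simp add: divided_power_def mult_ac)
qed

subsection \<open>The relative gap of the exponential\<close>

definition gap_remainder :: "nat \<Rightarrow> real \<Rightarrow> real \<Rightarrow> real" where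
  "gap_remainder m s c = (1 / fact (Suc (Suc m)) - real (m + 3) * cone_exp_moment m s c) / exp s"

definition exp_rel_gap :: "nat \<Rightarrow> real \<Rightarrow> real \<Rightarrow> real" where
  "exp_rel_gap m s c = (exp_moment m c + gap_remainder m s c) /
    ((1 + real (Suc m) * exp c) / fact (Suc (Suc m)) + gap_remainder m s c)"

lemma ridge_integral_exp_minus_1:
  "ridge_integral m (\<lambda>a. exp a - 1) s c = exp s * exp_moment m c - 1 / fact (Suc m)"
proof -
  have "((\<lambda>r. exp (s + c * r) * divided_power m r - divided_power m r) has_integral
      ridge_integral m exp s c - 1 / fact (Suc m)) {0..1}"
    by (intro has_integral_diff has_integral_ridge_integral has_integral_divided_power continuous_intros)
  then show ?thesis
    unfolding ridge_integral_def[of m "\<lambda>a. exp a - 1"] ridge_integral_exp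
    by (intro integral_unique) (simp add: left_diff_distrib)
qed

lemma cone_ridge_integral_exp_minus_1:
  "cone_ridge_integral m (\<lambda>a. exp a - 1) s c = cone_exp_moment m s c - 1 / fact (Suc (Suc m))"
proof -
  have "((\<lambda>z. z ^ Suc m * (exp (z * s) * exp_moment m (z * c)) - 1 / fact (Suc m) * z ^ Suc m) has_integral
      cone_exp_moment m s c - 1 / fact (Suc m) * (1 / real (Suc (Suc m)))) {0..1}"
    by (intro has_integral_diff has_integral_mult_right has_integral_cone_exp_moment has_integral_power)
  then show ?thesis
    unfolding cone_ridge_integral_def[of m "\<lambda>a. exp a - 1"] ridge_integral_exp_minus_1
    by (intro integral_unique) (simp add: right_diff_distrib mult_ac)
qed

lemma One_inner_vec: "One \<bullet> x = (\<Sum>i\<in>UNIV. (x :: real^'n) $ i)"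
proof -
  have "(One :: real^'n) $ i = 1" for i
    by (simp add: cart_eq_inner_axis inner_sum_left inner_Basis)
  then show ?thesis by (simp add: inner_vec_def)
qed

lemma expf_eq_ridge: "expf = (\<lambda>x::real^'n. exp (One \<bullet> x) - 1)"
  by (simp add: fun_eq_iff expf_def One_inner_vec)

lemma corner_vertices_vec:
  "corner_vertices v c = insert (v :: real^'n) (range (\<lambda>j. v + c *\<^sub>R axis j 1))"
proof -
  have Basis_eq: "Basis = range (\<lambda>j::'n. axis j (1::real))"
    by (auto simp: Basis_vec_def)
  show ?thesis
    unfolding corner_vertices_def Basis_eq image_image ..
qed

lemma rel_gap_expf_corner:
  fixes v :: "real^'n"
  assumes "c \<noteq> 0" "CARD('n) = Suc m"
  shows "rel_gap expf (corner_vertices v c) = exp_rel_gap m (One \<bullet> v) c"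
proof -
  let ?s = "One \<bullet> v" and ?N = "real (m + 3) * cone_exp_moment m (One \<bullet> v) c"
  define D where "D = (fact (Suc (Suc m)) :: real)"
  have fact_eq: "1 / fact (Suc m) = real (Suc (Suc m)) / D" and "D \<noteq> 0"
    by (auto simp: D_def)
  have "convex_on UNIV (\<lambda>a::real. exp a - 1)"
    by (intro convex_on_diff exp_convex) (simp add: concave_on_const)
  then have "rel_gap expf (corner_vertices v c) =
    (exp ?s * exp_moment m c - 1 / fact (Suc m) - (?N - real (m + 3) / D)) /
    ((exp ?s - 1 + real (Suc m) * (exp (?s + c) - 1)) / D - (?N - real (m + 3) / D))"
    unfolding expf_eq_ridge D_def
    by (subst rel_gap_ridge_corner[OF _ _ _ assms])
      (auto simp: chord_integral_def ridge_integral_exp_minus_1 cone_ridge_integral_exp_minus_1 right_diff_distrib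
        intro!: continuous_intros simp del: fact_Suc)
  also have "exp ?s * exp_moment m c - 1 / fact (Suc m) - (?N - real (m + 3) / D)
      = exp ?s * (exp_moment m c + gap_remainder m ?s c)"
    unfolding fact_eq gap_remainder_def D_def[symmetric] using \<open>D \<noteq> 0\<close> by (simp add: field_simps)
  also have "(exp ?s - 1 + real (Suc m) * (exp (?s + c) - 1)) / D - (?N - real (m + 3) / D)
      = exp ?s * ((1 + real (Suc m) * exp c) / D + gap_remainder m ?s c)"
    unfolding gap_remainder_def D_def[symmetric] using \<open>D \<noteq> 0\<close> by (simp add: exp_add field_simps)
  finally show ?thesis
    by (simp add: exp_rel_gap_def D_def)
qed

subsection \<open>Asymptotics of the relative gap\<close>

lemma tendsto_mult_perturbed_divide:
  fixes p q A B E :: "'a \<Rightarrow> real"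
  assumes main_num: "((\<lambda>u. p u * A u / q u) \<longlongrightarrow> \<alpha>) F"
    and main_den: "((\<lambda>u. B u / q u) \<longlongrightarrow> \<beta>) F" and "\<beta> \<noteq> 0"
    and remainder: "((\<lambda>u. p u * E u / q u) \<longlongrightarrow> 0) F"
    and p_at_top: "filterlim p at_top F" and q_nonzero: "\<And>u. q u \<noteq> 0"
  shows "((\<lambda>u. p u * ((A u + E u) / (B u + E u))) \<longlongrightarrow> \<alpha> / \<beta>) F"
proof -
  have p_nonzero: "\<forall>\<^sub>F u in F. p u \<noteq> 0"
    using filterlim_at_top_dense[THEN iffD1, OF p_at_top, rule_format, of 0] by eventually_elim simp
  have "((\<lambda>u. p u * E u / q u / p u) \<longlongrightarrow> 0) F"
    using remainder p_at_top by (rule real_tendsto_divide_at_top)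
  then have remainder_den: "((\<lambda>u. E u / q u) \<longlongrightarrow> 0) F"
    by (rule Lim_transform_eventually) (use p_nonzero in eventually_elim, simp)
  have "((\<lambda>u. (p u * A u / q u + p u * E u / q u) / (B u / q u + E u / q u)) \<longlongrightarrow> (\<alpha> + 0) / (\<beta> + 0)) F"
    using \<open>\<beta> \<noteq> 0\<close> by (intro tendsto_intros main_num main_den remainder remainder_den) simp
  moreover have "(p u * A u / q u + p u * E u / q u) / (B u / q u + E u / q u)
      = p u * ((A u + E u) / (B u + E u))" for u
    using q_nonzero[of u] by (simp add: distrib_left flip: add_divide_distrib)
  ultimately show ?thesis by simp
qed

lemma gap_remainder_uminus_tendsto:
  assumes "0 < a"
  shows "((\<lambda>u. u ^ Suc m * gap_remainder m (a * u) (- u)) \<longlongrightarrow> 0) at_top"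
proof -
  let ?N = "\<lambda>u. u ^ Suc m * cone_exp_moment m (a * u) (- u) / exp (a * u)"
  have "(?N \<longlongrightarrow> 0) at_top"
  proof (rule tendsto_sandwich[of "\<lambda>_. 0" _ _ "\<lambda>u. exp_moment 0 (a * u) / exp (a * u)"])
    show "\<forall>\<^sub>F u in at_top. 0 \<le> ?N u"
      using eventually_ge_at_top[of "0::real"] by eventually_elim (simp add: cone_exp_moment_nonneg)
    show "\<forall>\<^sub>F u in at_top. ?N u \<le> exp_moment 0 (a * u) / exp (a * u)"
      using eventually_ge_at_top[of "0::real"]
      by eventually_elim (intro divide_right_mono power_mult_cone_exp_moment_uminus_le, auto)
    have "filterlim (\<lambda>u. a * u) at_top at_top"
      using assms by real_asymp
    then show "((\<lambda>u. exp_moment 0 (a * u) / exp (a * u)) \<longlongrightarrow> 0) at_top"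
      by (rule filterlim_compose[OF exp_moment_div_exp_tendsto_0])
  qed simp
  moreover have "((\<lambda>u. u ^ Suc m / exp (a * u) / fact (Suc (Suc m))) \<longlongrightarrow> 0) at_top"
    using assms by real_asymp
  ultimately have "((\<lambda>u. u ^ Suc m / exp (a * u) / fact (Suc (Suc m)) - real (m + 3) * ?N u)
      \<longlongrightarrow> 0 - real (m + 3) * 0) at_top"
    by (intro tendsto_intros)
  then show ?thesis
    by (simp add: gap_remainder_def diff_divide_distrib right_diff_distrib mult_ac del: fact_Suc power_Suc)
qed

lemma gap_remainder_tendsto:
  assumes "0 \<le> s"
  shows "((\<lambda>u. u * gap_remainder m s u / exp u) \<longlongrightarrow> 0) at_top"
proof -
  let ?N = "\<lambda>u. u * cone_exp_moment m s u / exp (s + u)"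
  have "(?N \<longlongrightarrow> 0) at_top"
  proof (rule tendsto_sandwich[OF _ _ tendsto_const exp_moment_div_exp_tendsto_0[of 0]])
    show "\<forall>\<^sub>F u in at_top. 0 \<le> ?N u"
      using eventually_ge_at_top[of "0::real"] by eventually_elim (simp add: cone_exp_moment_nonneg)
    show "\<forall>\<^sub>F u in at_top. ?N u \<le> exp_moment 0 u / exp u"
      using eventually_ge_at_top[of "0::real"]
      by eventually_elim (use mult_cone_exp_moment_le[OF _ assms] in \<open>simp add: exp_add field_simps\<close>)
  qed
  moreover have "((\<lambda>u. u / exp (s + u) / fact (Suc (Suc m))) \<longlongrightarrow> 0) at_top"
    by real_asymp
  ultimately have "((\<lambda>u. u / exp (s + u) / fact (Suc (Suc m)) - real (m + 3) * ?N u)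
      \<longlongrightarrow> 0 - real (m + 3) * 0) at_top"
    by (intro tendsto_intros)
  then show ?thesis
    by (simp add: gap_remainder_def diff_divide_distrib right_diff_distrib exp_add mult_ac del: fact_Suc)
qed

lemma exp_rel_gap_uminus_tendsto:
  assumes "0 < a"
  shows "((\<lambda>u. u ^ Suc m * exp_rel_gap m (a * u) (- u)) \<longlongrightarrow> fact (Suc (Suc m))) at_top"
proof -
  let ?B = "\<lambda>u::real. (1 + real (Suc m) * exp (- u)) / fact (Suc (Suc m))"
  have "((\<lambda>u::real. exp (- u)) \<longlongrightarrow> 0) at_top"
    by real_asymp
  then have "(?B \<longlongrightarrow> (1 + real (Suc m) * 0) / fact (Suc (Suc m))) at_top"
    by (intro tendsto_intros) (simp_all del: fact_Suc)
  moreover have "filterlim (\<lambda>u::real. u ^ Suc m) at_top at_top"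
    by real_asymp
  ultimately have "((\<lambda>u. u ^ Suc m * exp_rel_gap m (a * u) (- u)) \<longlongrightarrow> 1 / (1 / fact (Suc (Suc m)))) at_top"
    unfolding exp_rel_gap_def
    by (intro tendsto_mult_perturbed_divide[where q="\<lambda>_. 1"])
      (use power_mult_exp_moment_uminus_tendsto gap_remainder_uminus_tendsto[OF assms]
        in \<open>simp_all del: power_Suc fact_Suc\<close>)
  then show ?thesis by (simp del: fact_Suc)
qed

lemma exp_rel_gap_tendsto:
  assumes "0 \<le> s"
  shows "((\<lambda>u. u * exp_rel_gap m s u) \<longlongrightarrow> real (Suc (Suc m))) at_top"
proof -
  let ?B = "\<lambda>u::real. (1 + real (Suc m) * exp u) / fact (Suc (Suc m))"
  let ?\<beta> = "real (Suc m) / fact (Suc (Suc m))"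
  have "((\<lambda>u::real. exp (- u)) \<longlongrightarrow> 0) at_top"
    by real_asymp
  then have "((\<lambda>u. (exp (- u) + real (Suc m)) / fact (Suc (Suc m)))
      \<longlongrightarrow> (0 + real (Suc m)) / fact (Suc (Suc m))) at_top"
    by (intro tendsto_intros) (simp_all del: fact_Suc)
  moreover have "(exp (- u) + real (Suc m)) / fact (Suc (Suc m)) = ?B u / exp u" for u
    by (simp add: exp_minus field_simps del: of_nat_Suc fact_Suc)
  ultimately have "((\<lambda>u. ?B u / exp u) \<longlongrightarrow> ?\<beta>) at_top"
    by simp
  then have "((\<lambda>u. u * exp_rel_gap m s u) \<longlongrightarrow> 1 / fact m / ?\<beta>) at_top"
    unfolding exp_rel_gap_def
    by (intro tendsto_mult_perturbed_divide[where q=exp] mult_exp_moment_div_exp_tendsto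
        gap_remainder_tendsto assms filterlim_ident) auto
  moreover have "1 / fact m / ?\<beta> = real (Suc (Suc m))"
    by simp
  ultimately show ?thesis by simp
qed

lemma rel_gap_shrinking_corner_tendsto:
  fixes k :: real
  assumes "0 < k"
  shows "((\<lambda>u. u ^ CARD('n) * rel_gap expf (corner_vertices ((\<chi> i. k * u) :: real^'n) (- u)))
    \<longlongrightarrow> fact (CARD('n) + 1)) at_top"
proof -
  obtain m where CARD_eq: "CARD('n) = Suc m"
    using not0_implies_Suc[of "CARD('n)"] by auto
  have "((\<lambda>u. u ^ Suc m * exp_rel_gap m (real (Suc m) * k * u) (- u)) \<longlongrightarrow> fact (Suc (Suc m))) at_top"
    using assms by (intro exp_rel_gap_uminus_tendsto) simp
  moreover have "\<forall>\<^sub>F u in at_top. u ^ Suc m * exp_rel_gap m (real (Suc m) * k * u) (- u)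
      = u ^ CARD('n) * rel_gap expf (corner_vertices ((\<chi> i. k * u) :: real^'n) (- u))"
    using eventually_gt_at_top[of 0]
    by eventually_elim (simp add: rel_gap_expf_corner[OF _ CARD_eq] One_inner_vec CARD_eq mult.assoc)
  ultimately have "((\<lambda>u. u ^ CARD('n) * rel_gap expf (corner_vertices ((\<chi> i. k * u) :: real^'n) (- u)))
    \<longlongrightarrow> fact (Suc (Suc m))) at_top"
    by (rule Lim_transform_eventually)
  then show ?thesis by (simp add: CARD_eq del: fact_Suc)
qed

lemma rel_gap_growing_corner_tendsto:
  fixes v :: "real^'n"
  assumes "0 \<le> One \<bullet> v"
  shows "((\<lambda>u. u * rel_gap expf (corner_vertices v u)) \<longlongrightarrow> real (CARD('n) + 1)) at_top"
proof -
  obtain m where CARD_eq: "CARD('n) = Suc m"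
    using not0_implies_Suc[of "CARD('n)"] by auto
  have "\<forall>\<^sub>F u in at_top. u * exp_rel_gap m (One \<bullet> v) u = u * rel_gap expf (corner_vertices v u)"
    using eventually_gt_at_top[of 0] by eventually_elim (simp add: rel_gap_expf_corner[OF _ CARD_eq])
  with exp_rel_gap_tendsto[OF assms, of m]
  have "((\<lambda>u. u * rel_gap expf (corner_vertices v u)) \<longlongrightarrow> real (Suc (Suc m))) at_top"
    by (rule Lim_transform_eventually)
  then show ?thesis by (simp add: CARD_eq)
qed

theorem theorem14:
  shows
   "(\<forall>k::real. k > 0 \<longrightarrow>
       ((\<lambda>u::real. u ^ CARD('n) *
          rel_gap (expf :: real^'n \<Rightarrow> real)
            (insert (\<chi> i. k * u)
               ((\<lambda>j. (\<chi> i. k * u) - u *\<^sub>R axis j 1) ` UNIV)))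
        \<longlongrightarrow> fact (CARD('n) + 1)) at_top)
    \<and> (\<forall>v0::real^'n. (\<forall>i. 0 \<le> v0 $ i) \<and> v0 \<noteq> 0 \<longrightarrow>
       ((\<lambda>u::real. u *
          rel_gap (expf :: real^'n \<Rightarrow> real)
            (insert v0 ((\<lambda>j. v0 + u *\<^sub>R axis j 1) ` UNIV)))
        \<longlongrightarrow> real (CARD('n) + 1)) at_top)"
proof (intro conjI allI impI, goal_cases shrinking growing)
  case (shrinking k)
  then show ?case
    using rel_gap_shrinking_corner_tendsto[of k] by (simp add: corner_vertices_vec)
next
  case (growing v0)
  then show ?case
    using rel_gap_growing_corner_tendsto[of v0] by (simp add: corner_vertices_vec One_inner_vec sum_nonneg)
qed

end
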